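(* Let $R>0$ and let $S\subset\mathbb{R}^3$ be a nonempty compact set whose volume function satisfies $$V(r;S)=\mu(S)+L_0 r+Mr^2+\tfrac43\pi r^3,\qquad 0\le r<R,$$ for some constants $L_0,M$. Let $X$ be uniformly distributed on $B(S,R)\setminus S$ and let $D=\mathcal{D}(X,S)$. Then the random variable $D$ is absolutely continuous with density function $$f(r;L_0,M)=\frac{L_0+2Mr+4\pi r^2}{L_0R+MR^2+\frac43\pi R^3},\qquad 0\le r<R.$$ This density can be alternatively expressed as $$f(r)=\lambda_1f_1(r)+\lambda_2f_2(r)+\lambda_3f_3(r),\qquad 0\le r<R,$$ where $$\lambda_1=\frac{L_0}{L_0+MR+4\pi R^2/3},\quad \lambda_2=\frac{MR}{L_0+MR+4\pi R^2/3},\quad \lambda_3=\frac{4\pi R^2/3}{L_0+MR+4\pi R^2/3},$$ and, for $i=1,2,3$, $f_i$ is the density function of the random variable $RZ_i$, where $Z_1$ is uniform on $(0,1)$, $Z_2$ has a $\mathrm{Beta}(2,1)$ distribution and $Z_3$ has a $\mathrm{Beta}(3,1)$ distribution.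
   Context: For $x\in\mathbb{R}^3$, $\mathcal{D}(x,S)=\inf_{y\in S}\|x-y\|$ is the Euclidean distance to $S$; $B(S,r)=\{x:\mathcal{D}(x,S)\le r\}$ is the closed $r$-parallel set; $\mu$ is Lebesgue measure on $\mathbb{R}^3$; $V(r;S)=\mu(B(S,r))$ is the volume function of $S$. Densities are understood up to Lebesgue-null sets. *)

theory Defs
  imports "HOL-Probability.Probability"
begin

definition parallel_set :: "'a::euclidean_space set \<Rightarrow> real \<Rightarrow> 'a set"
  where "parallel_set S r = {x. infdist x S \<le> r}"

definition volume_function :: "real \<Rightarrow> 'a::euclidean_space set \<Rightarrow> real"
  where "volume_function r S = measure lborel (parallel_set S r)"

definition uniformly_distributed ::
    "'w measure \<Rightarrow> ('w \<Rightarrow> 'a::euclidean_space) \<Rightarrow> 'a set \<Rightarrow> bool"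
  where "uniformly_distributed P X A \<longleftrightarrow>
    X \<in> measurable P lborel \<and> distr P lborel X = uniform_measure lborel A"

text \<open>Nonnegativity is required explicitly because \<^const>\<open>ennreal\<close> sends negative reals to \<open>0\<close>.\<close>

definition has_density :: "'w measure \<Rightarrow> ('w \<Rightarrow> real) \<Rightarrow> (real \<Rightarrow> real) \<Rightarrow> bool"
  where "has_density P X f \<longleftrightarrow>
    (AE r in lborel. 0 \<le> f r) \<and> distributed P lborel X (\<lambda>r. ennreal (f r))"

definition beta_density :: "real \<Rightarrow> real \<Rightarrow> real \<Rightarrow> real"
  where "beta_density a b x =
    (if 0 < x \<and> x < 1 then x powr (a - 1) * (1 - x) powr (b - 1) / Beta a b else 0)"

definition distance_density :: "real \<Rightarrow> real \<Rightarrow> real \<Rightarrow> real \<Rightarrow> real"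
  where "distance_density R L0 M r =
    (if 0 \<le> r \<and> r < R
     then (L0 + 2 * M * r + 4 * pi * r\<^sup>2) / (L0 * R + M * R\<^sup>2 + 4 / 3 * pi * R ^ 3)
     else 0)"

definition weight1 :: "real \<Rightarrow> real \<Rightarrow> real \<Rightarrow> real"
  where "weight1 R L0 M = L0 / (L0 + M * R + 4 * pi * R\<^sup>2 / 3)"

definition weight2 :: "real \<Rightarrow> real \<Rightarrow> real \<Rightarrow> real"
  where "weight2 R L0 M = M * R / (L0 + M * R + 4 * pi * R\<^sup>2 / 3)"

definition weight3 :: "real \<Rightarrow> real \<Rightarrow> real \<Rightarrow> real"
  where "weight3 R L0 M = (4 * pi * R\<^sup>2 / 3) / (L0 + M * R + 4 * pi * R\<^sup>2 / 3)"

end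

theory Submission
  imports Defs
begin

text \<open>
  The distance has the distribution function \<open>(V r - V 0) / (V R - V 0)\<close>, whose derivative is the
  stated density; the density is nonnegative because the volume function is monotone. As the volume
  formula is only given for \<open>r < R\<close>, one also needs that the level set of points at distance exactly
  \<open>R\<close> is null. Covering \<open>S\<close> by finitely many balls of radius \<open>R / 2\<close> reduces this to a set \<open>T\<close> inside
  one ball with centre \<open>p\<close>. Moving a point at distance \<open>\<ge> R\<close> from \<open>T\<close> away from \<open>p\<close> increases its
  distance to every point of \<open>T\<close>, so each ray from \<open>p\<close> meets the level set at most once.
\<close>

section \<open>Level sets of the distance function are null\<close>

lemma infdist_attained:
  fixes S :: "'a::heine_borel set"
  assumes "closed S" "S \<noteq> {}"
  obtains s where "s \<in> S" "infdist x S = dist x s"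
proof -
  obtain s where s: "s \<in> S" "\<And>y. y \<in> S \<Longrightarrow> dist x s \<le> dist x y"
    using distance_attains_inf[OF assms] by blast
  have "infdist x S = dist x s"
  proof (rule antisym)
    show "infdist x S \<le> dist x s" using s(1) by (rule infdist_le)
    show "dist x s \<le> infdist x S"
      unfolding infdist_notempty[OF assms(2)] using assms(2) s(2) by (intro cINF_greatest)
  qed
  with s(1) show thesis by (rule that)
qed

lemma closed_infdist_level: "closed {x. infdist x S = r}"
  by (intro closed_Collect_eq continuous_intros)

text \<open>The point \<open>y = c *\<^sub>R x\<close> has norm at least \<open>r / 2\<close>, hence
  at least \<open>norm v\<close>, and Cauchy-Schwarz gives
  \<open>0 \<le> y \<bullet> (y - v)\<close>. So \<open>y\<close> moves away from \<open>v\<close>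
  when it is pushed further out along its own ray.\<close>

lemma norm_radial_less:
  fixes x v :: "'a::real_inner"
  assumes "norm v \<le> r / 2" "0 < r" "r \<le> norm (c *\<^sub>R x - v)" "0 \<le> c" "c < 1"
  shows "norm (c *\<^sub>R x - v) < norm (x - v)"
proof -
  define y where "y = c *\<^sub>R x"
  have "norm (y - v) \<le> norm y + norm v" by (rule norm_triangle_ineq4)
  then have ny: "norm y \<ge> r / 2" using assms by (simp add: y_def)
  then have "c \<noteq> 0" using assms(2) by (auto simp: y_def)
  then have c: "0 < c" using assms(4) by simp
  define t where "t = 1 / c - 1"
  have t: "t > 0" using c assms(5) by (simp add: t_def)
  have x: "x = y + t *\<^sub>R y" using c by (simp add: y_def t_def algebra_simps)
  have "y \<bullet> v \<le> norm y * norm v" by (rule norm_cauchy_schwarz)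
  also have "\<dots> \<le> norm y * norm y" using ny assms(1) by (intro mult_left_mono) auto
  finally have yv: "0 \<le> y \<bullet> (y - v)"
    by (simp add: inner_diff_right power2_norm_eq_inner[symmetric] power2_eq_square)
  have "y \<noteq> 0" using ny assms(2) by auto
  \<comment> \<open>Expansion of \<open>y - v + t *\<^sub>R y\<close>: the cross term is nonnegative
    by \<open>yv\<close>, and the last term makes the inequality strict.\<close>
  have "(norm (x - v))\<^sup>2 = (norm (y - v))\<^sup>2 + 2 * t * (y \<bullet> (y - v)) + t\<^sup>2 * (norm y)\<^sup>2"
    unfolding x power2_norm_eq_inner
    by (simp add: algebra_simps inner_add_left inner_diff_left inner_add_right inner_diff_right
        inner_commute power2_eq_square)
  moreover have "t\<^sup>2 * (norm y)\<^sup>2 > 0" using t \<open>y \<noteq> 0\<close> by simp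
  moreover have "2 * t * (y \<bullet> (y - v)) \<ge> 0" using t yv by simp
  ultimately have "(norm (y - v))\<^sup>2 < (norm (x - v))\<^sup>2" by linarith
  then show ?thesis unfolding y_def by (rule power2_less_imp_less) simp
qed

text \<open>If \<open>p + x\<close> and \<open>p + c *\<^sub>R x\<close> both lay on the level set,
  the point \<open>s\<close> of \<open>T\<close> nearest to \<open>p + x\<close> would have distance
  at least \<open>r\<close> from \<open>p + c *\<^sub>R x\<close>, so by
  \<open>norm_radial_less\<close> more than \<open>r\<close> from \<open>p + x\<close>, although
  that distance is exactly \<open>r\<close>.\<close>

lemma negligible_infdist_level_small:
  fixes T :: "'a::euclidean_space set"
  assumes "closed T" "T \<noteq> {}" "T \<subseteq> cball p (r / 2)" "0 < r"
  shows "negligible {x. infdist x T = r}"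
proof (rule starlike_negligible_strong[where a = p])
  fix c :: real and x :: 'a
  assume c: "0 \<le> c" "c < 1" and "p + x \<in> {x. infdist x T = r}"
  show "p + c *\<^sub>R x \<notin> {x. infdist x T = r}"
  proof
    assume cx: "p + c *\<^sub>R x \<in> {x. infdist x T = r}"
    obtain s where s: "s \<in> T" "infdist (p + x) T = dist (p + x) s"
      using infdist_attained[OF assms(1,2)] .
    have "infdist (p + c *\<^sub>R x) T \<le> dist (p + c *\<^sub>R x) s" using s(1) by (rule infdist_le)
    with cx have "r \<le> norm (c *\<^sub>R x - (s - p))" by (simp add: dist_norm algebra_simps)
    moreover have "norm (s - p) \<le> r / 2"
      using s(1) assms(3) by (auto simp: dist_norm norm_minus_commute)
    ultimately have "norm (c *\<^sub>R x - (s - p)) < norm (x - (s - p))"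
      using c assms(4) by (intro norm_radial_less) auto
    with \<open>r \<le> norm (c *\<^sub>R x - (s - p))\<close> s(2) \<open>p + x \<in> _\<close> show False
      by (simp add: dist_norm algebra_simps)
  qed
qed (rule closed_infdist_level)

lemma null_sets_infdist_level:
  fixes S :: "'a::euclidean_space set"
  assumes "compact S" "S \<noteq> {}" "0 < r"
  shows "{x. infdist x S = r} \<in> null_sets lborel"
proof -
  have cS: "closed S" using assms(1) by (rule compact_imp_closed)
  obtain F where F: "F \<subseteq> S" "finite F" "S \<subseteq> (\<Union>p\<in>F. ball p (r / 2))"
    by (rule compactE_image[OF assms(1), of S "\<lambda>p. ball p (r / 2)"]) (use assms(3) in auto)
  \<comment> \<open>Restricting \<open>S\<close> to a piece that contains a nearest point of
    \<open>x\<close> leaves the distance of \<open>x\<close> unchanged.\<close>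
  have "{x. infdist x S = r} \<subseteq> (\<Union>p\<in>F. {x. infdist x (S \<inter> cball p (r / 2)) = r})"
  proof
    fix x assume "x \<in> {x. infdist x S = r}"
    moreover obtain s where s: "s \<in> S" "infdist x S = dist x s"
      using infdist_attained[OF cS assms(2)] .
    ultimately have r: "infdist x S = r" "dist x s = r" by simp_all
    obtain p where p: "p \<in> F" "s \<in> ball p (r / 2)" using F(3) s(1) by auto
    then have sT: "s \<in> S \<inter> cball p (r / 2)" using s(1) by auto
    then have "infdist x (S \<inter> cball p (r / 2)) \<le> r" using r(2) infdist_le by metis
    moreover have "infdist x (S \<inter> cball p (r / 2)) \<ge> r"
      using sT unfolding r(1)[symmetric] by (intro infdist_mono) auto
    ultimately show "x \<in> (\<Union>p\<in>F. {x. infdist x (S \<inter> cball p (r / 2)) = r})"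
      using p(1) by auto
  qed
  moreover have "negligible (\<Union>p\<in>F. {x. infdist x (S \<inter> cball p (r / 2)) = r})"
  proof (rule negligible_Union, use F(2) in simp, safe)
    fix p assume "p \<in> F"
    \<comment> \<open>The centres lie in \<open>S\<close>, so each piece contains its own centre and
      is nonempty.\<close>
    then show "negligible {x. infdist x (S \<inter> cball p (r / 2)) = r}"
      using F(1) assms(3) cS by (intro negligible_infdist_level_small) (auto intro!: closed_Int)
  qed
  ultimately have "negligible {x. infdist x S = r}" by (rule negligible_subset[rotated])
  \<comment> \<open>Negligibility concerns the completed measure; it passes to \<open>lborel\<close>
    because the level set is closed, hence Borel.\<close>
  then show ?thesis
    by (simp add: negligible_iff_null_sets null_sets_completion_iff closed_infdist_level borel_closed)
qed

section \<open>Parallel sets and left continuity of their volume\<close>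

lemma closed_parallel_set: "closed (parallel_set S r)"
  unfolding parallel_set_def by (intro closed_Collect_le continuous_intros)

lemma parallel_set_0:
  assumes "closed S" "S \<noteq> {}"
  shows "parallel_set S 0 = S"
  using in_closed_iff_infdist_zero[OF assms] infdist_nonneg
  by (auto simp: parallel_set_def intro: antisym)

lemma parallel_set_mono: "r \<le> s \<Longrightarrow> parallel_set S r \<subseteq> parallel_set S s"
  by (auto simp: parallel_set_def)

lemma compact_parallel_set:
  assumes "compact S" "S \<noteq> {}" "0 \<le> r"
  shows "compact (parallel_set S r)"
proof (cases "r = 0")
  case True
  then show ?thesis using assms by (simp add: parallel_set_0 compact_imp_closed)
next
  case False
  then show ?thesis using assms compact_infdist_le[of S r] by (simp add: parallel_set_def)
qed

lemma emeasure_parallel_set: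
  assumes "compact S" "S \<noteq> {}" "0 \<le> r"
  shows "emeasure lborel (parallel_set S r) = ennreal (volume_function r S)"
  unfolding volume_function_def
  using emeasure_compact_finite[OF compact_parallel_set[OF assms]]
  by (intro emeasure_eq_ennreal_measure) auto

lemma volume_function_mono:
  assumes "compact S" "S \<noteq> {}" "0 \<le> r" "r \<le> s"
  shows "volume_function r S \<le> volume_function s S"
  unfolding volume_function_def
  using emeasure_compact_finite[OF compact_parallel_set[OF assms(1,2), of s]] assms(3,4)
  by (intro measure_mono_fmeasurable parallel_set_mono fmeasurableI)
     (auto intro: borel_closed closed_parallel_set)

text \<open>Parallel sets with radii increasing strictly below \<open>R\<close> to the limit
  \<open>R\<close> exhaust the parallel set of radius \<open>R\<close> up to the level set at
  distance \<open>R\<close>. That level set is null, so continuity from below applies.\<close>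

lemma volume_function_left_continuous:
  fixes S :: "'a::euclidean_space set"
  assumes "compact S" "S \<noteq> {}" "0 < R"
  shows "((\<lambda>r. volume_function r S) \<longlongrightarrow> volume_function R S) (at_left R)"
proof (rule tendsto_at_left_sequentially[OF assms(3)])
  fix r :: "nat \<Rightarrow> real"
  assume r: "\<And>n. r n < R" "\<And>n. 0 < r n" "incseq r" "r \<longlonglongrightarrow> R"
  have borel: "parallel_set S t \<in> sets lborel" for t
    by (simp add: borel_closed closed_parallel_set)
  have Un: "(\<Union>n. parallel_set S (r n)) = parallel_set S R - {x. infdist x S = R}"
  proof -
    have "\<exists>n. infdist x S \<le> r n" if "infdist x S < R" for x
      using order_tendstoD(1)[OF r(4) that] by (meson eventually_happens' less_imp_le sequentially_bot)
    moreover have "infdist x S < R" if "infdist x S \<le> r n" for x n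
      using that r(1)[of n] by simp
    ultimately have "(\<exists>n. infdist x S \<le> r n) \<longleftrightarrow> infdist x S < R" for x
      by blast
    then show ?thesis by (simp add: parallel_set_def set_eq_iff less_le)
  qed
  have null: "{x. infdist x S = R} \<in> null_sets lborel"
    using assms by (rule null_sets_infdist_level)
  have "emeasure lborel (\<Union>n. parallel_set S (r n)) = emeasure lborel (parallel_set S R)"
    unfolding Un using null borel by (rule emeasure_Diff_null_set)
  moreover from this have "measure lborel (\<Union>n. parallel_set S (r n)) = volume_function R S"
    by (simp add: volume_function_def measure_def)
  moreover have "(\<lambda>n. measure lborel (parallel_set S (r n)))
      \<longlonglongrightarrow> measure lborel (\<Union>n. parallel_set S (r n))"
    using borel r(3) calculation(1) assms
    by (intro Lim_measure_incseq)
       (auto simp: incseq_def emeasure_parallel_set intro!: parallel_set_mono)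
  ultimately show "(\<lambda>n. volume_function (r n) S) \<longlonglongrightarrow> volume_function R S"
    by (simp add: volume_function_def)
qed

section \<open>Uniqueness and scaling of densities; the reference laws\<close>

lemma distributed_cong_AE:
  assumes "distributed M N X f" "AE x in N. f x = g x" "g \<in> borel_measurable N"
  shows "distributed M N X g"
  using assms density_cong[of f N g] by (simp add: distributed_def)

lemma has_density_unique:
  assumes "prob_space P" "has_density P X f" "has_density P X g"
  shows "AE x in lborel. f x = g x"
proof -
  have "AE x in lborel. ennreal (f x) = ennreal (g x)"
    using assms by (intro prob_space.distributed_unique) (auto simp: has_density_def)
  \<comment> \<open>\<open>ennreal\<close> is injective only on nonnegative reals, so signs are
    needed to return to real equality.\<close>
  moreover have "AE x in lborel. 0 \<le> f x" "AE x in lborel. 0 \<le> g x"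
    using assms by (auto simp: has_density_def)
  ultimately show ?thesis by eventually_elim auto
qed

text \<open>The change of variables \<open>x / R\<close> for the law of \<open>R * Z\<close>. The
  point 0 is exempt because the laws of the \<open>Z\<close> live on the open interval
  \<open>(0, 1)\<close>, whereas the target densities are prescribed on \<open>[0, R)\<close>; a
  single point is null.\<close>

lemma has_density_scaled:
  fixes f :: "real \<Rightarrow> real"
  assumes "prob_space P" "distributed P lborel Z (\<lambda>x. ennreal (h x))" "0 < R"
    and "g \<in> borel_measurable borel"
    and "\<And>x. 0 \<le> g x" "\<And>x. x \<noteq> 0 \<Longrightarrow> h (x / R) / R = g x"
  shows "has_density P (\<lambda>\<omega>. R * Z \<omega>) g"
  unfolding has_density_def
proof
  show "AE x in lborel. 0 \<le> g x" using assms(5) by simp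
  have "distributed P lborel (\<lambda>\<omega>. 0 + R * Z \<omega>) (\<lambda>x. ennreal (h ((x - 0) / R)) / ennreal \<bar>R\<bar>)"
    using assms by (intro prob_space.distributed_affine) auto
  then have "distributed P lborel (\<lambda>\<omega>. R * Z \<omega>) (\<lambda>x. ennreal (h (x / R)) / ennreal \<bar>R\<bar>)"
    by simp
  then show "distributed P lborel (\<lambda>\<omega>. R * Z \<omega>) (\<lambda>x. ennreal (g x))"
  proof (rule distributed_cong_AE)
    have "ennreal (h (x / R)) / ennreal R = ennreal (g x)" if "x \<noteq> 0" for x
    proof -
      have "h (x / R) = R * g x" using assms(3) assms(6)[OF that] by (simp add: field_simps)
      then have "0 \<le> h (x / R)" using assms(3) assms(5)[of x] by simp
      then show ?thesis using assms(3,6) that by (simp add: divide_ennreal)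
    qed
    then show "AE x in lborel. ennreal (h (x / R)) / ennreal \<bar>R\<bar> = ennreal (g x)"
      using AE_lborel_singleton[of 0] assms(3) by (auto elim!: eventually_mono)
    show "(\<lambda>x. ennreal (g x)) \<in> borel_measurable lborel" using assms(4) by simp
  qed
qed

lemma uniformly_distributed_unit_interval:
  assumes "uniformly_distributed P Z {0<..<1::real}"
  shows "distributed P lborel Z (\<lambda>x. ennreal (indicator {0<..<1} x))"
proof -
  \<comment> \<open>The interval has measure 1, so the normalising division disappears.\<close>
  have "uniform_measure lborel {0<..<1::real} = density lborel (\<lambda>x. ennreal (indicator {0<..<1} x))"
    by (simp add: uniform_measure_def ennreal_indicator divide_ennreal_def)
  with assms show ?thesis by (simp add: uniformly_distributed_def distributed_def)
qed

lemma Beta_1_right: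
  fixes a :: real
  assumes "0 < a"
  shows "Beta a 1 = 1 / a"
proof -
  have "a \<notin> \<int>\<^sub>\<le>\<^sub>0" using assms nonpos_Ints_nonpos[of a] by auto
  then show ?thesis
    using Gamma_plus1[of a] Gamma_real_pos[OF assms] by (simp add: Beta_def)
qed

section \<open>The law of the distance\<close>

lemma volume_function_eq_at_endpoint:
  fixes S :: "'a::euclidean_space set"
  assumes "compact S" "S \<noteq> {}" "0 < R" "continuous_on {0..R} g"
    and "\<And>r. 0 \<le> r \<Longrightarrow> r < R \<Longrightarrow> volume_function r S = g r"
    and "0 \<le> r" "r \<le> R"
  shows "volume_function r S = g r"
proof (cases "r = R")
  case True
  \<comment> \<open>Both functions are left continuous at \<open>R\<close> and agree below
    \<open>R\<close>, so uniqueness of limits extends the formula to \<open>R\<close>.\<close>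
  have "(g \<longlongrightarrow> g R) (at_left R)"
    using assms(3,4) by (simp add: continuous_on_Icc_at_leftD)
  moreover have "((\<lambda>r. volume_function r S) \<longlongrightarrow> volume_function R S) (at_left R)"
    using assms(1-3) by (rule volume_function_left_continuous)
  moreover have "eventually (\<lambda>r. volume_function r S = g r) (at_left R)"
    using assms(3,5) eventually_at_left_real[of 0 R] by (auto elim!: eventually_mono)
  ultimately have "volume_function R S = g R"
    by (intro tendsto_unique[OF _ _ \<open>(g \<longlongrightarrow> g R) (at_left R)\<close>]) (auto dest: tendsto_cong)
  with True show ?thesis by simp
qed (use assms in auto)

text \<open>Monotonicity gives the sign in the open interval; continuity of \<open>g'\<close>
  carries it to the endpoints.\<close>

lemma deriv_nonneg_Icc:
  fixes g g' :: "real \<Rightarrow> real"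
  assumes "a < b" "mono_on {a..b} g" "\<And>x. x \<in> {a<..<b} \<Longrightarrow> (g has_real_derivative g' x) (at x)"
    "continuous_on {a..b} g'" "x \<in> {a..b}"
  shows "0 \<le> g' x"
proof (rule continuous_ge_on_closure[where S = "{a<..<b}" and f = g' and x = x])
  show "continuous_on (closure {a<..<b}) g'" "x \<in> closure {a<..<b}" using assms by auto
  fix y assume "y \<in> {a<..<b}"
  then show "0 \<le> g' y"
    using assms by (intro mono_on_imp_deriv_nonneg[of "{a..b}" g]) auto
qed

text \<open>The distribution function of the distance is a ratio of shell volumes, that is, of
  increments of \<open>g\<close>. The fundamental theorem of calculus identifies it with the
  integral of the normalised \<open>g'\<close>.\<close>

lemma has_density_infdist:
  fixes S :: "'a::euclidean_space set" and g g' :: "real \<Rightarrow> real"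
  assumes "0 < R" "compact S" "S \<noteq> {}"
    and vol: "\<And>r. 0 \<le> r \<Longrightarrow> r < R \<Longrightarrow> volume_function r S = g r"
    and deriv: "\<And>r. (g has_real_derivative g' r) (at r)"
    and cont: "continuous_on UNIV g'"
    and P: "prob_space P" "uniformly_distributed P X (parallel_set S R - S)"
  shows "has_density P (\<lambda>\<omega>. infdist (X \<omega>) S)
    (\<lambda>r. if 0 \<le> r \<and> r < R then g' r / (g R - g 0) else 0)"
proof -
  interpret P: prob_space P by fact
  let ?A = "parallel_set S R - S"
  let ?f = "\<lambda>r. if 0 \<le> r \<and> r < R then g' r / (g R - g 0) else 0"
  have cS: "closed S" using assms(2) by (rule compact_imp_closed)
  have borel: "parallel_set S r \<in> sets borel" "S \<in> sets borel" for r
    using cS closed_parallel_set by (auto intro: borel_closed)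
  have gcont: "continuous_on T g" for T
    using deriv by (meson DERIV_isCont continuous_at_imp_continuous_on)
  have V: "volume_function r S = g r" if "0 \<le> r" "r \<le> R" for r
    using assms(1-3) gcont vol that by (intro volume_function_eq_at_endpoint[of S R g r]) auto
  have "mono_on {0..R} g"
  proof (rule mono_onI)
    fix r s assume "r \<in> {0..R}" "s \<in> {0..R}" "r \<le> s"
    then show "g r \<le> g s" using volume_function_mono[OF assms(2,3), of r s] V by auto
  qed
  then have g'_nonneg: "0 \<le> g' r" if "r \<in> {0..R}" for r
    using assms(1) deriv cont that
    by (intro deriv_nonneg_Icc[of 0 R g g' r]) (auto intro: continuous_on_subset)
  have shell: "emeasure lborel (parallel_set S r - S) = ennreal (g r - g 0)" if "0 \<le> r" "r \<le> R" for r
  proof -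
    have "emeasure lborel (parallel_set S r - S)
        = emeasure lborel (parallel_set S r) - emeasure lborel S"
      using emeasure_compact_finite[OF assms(2)] borel that(1) parallel_set_mono[of 0 r S]
      by (intro emeasure_Diff) (auto simp: parallel_set_0[OF cS assms(3)])
    also have "\<dots> = ennreal (g r) - ennreal (g 0)"
      using emeasure_parallel_set[OF assms(2,3), of r] emeasure_parallel_set[OF assms(2,3), of 0]
        V[of r] V[of 0] that assms(1) by (simp add: parallel_set_0[OF cS assms(3)])
    \<comment> \<open>Merging the truncated subtraction requires \<open>0 \<le> g 0\<close>, which
      holds because \<open>g 0\<close> is a volume.\<close>
    also have "\<dots> = ennreal (g r - g 0)"
      using V[of 0] assms(1) by (simp add: ennreal_minus volume_function_def flip: V[of 0])
    finally show ?thesis .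
  qed
  have X[measurable]: "X \<in> borel_measurable P" and dX: "distr P lborel X = uniform_measure lborel ?A"
    using P(2) by (auto simp: uniformly_distributed_def)
  have law: "emeasure P {\<omega> \<in> space P. X \<omega> \<in> B} = emeasure lborel (?A \<inter> B) / emeasure lborel ?A"
    if "B \<in> sets borel" for B
  proof -
    have "emeasure P {\<omega> \<in> space P. X \<omega> \<in> B} = emeasure (distr P lborel X) B"
      using that by (subst emeasure_distr) (auto intro!: arg_cong[where f = "emeasure P"])
    also have "\<dots> = emeasure lborel (?A \<inter> B) / emeasure lborel ?A"
      unfolding dX using borel that by (subst emeasure_uniform_measure) auto
    finally show ?thesis .
  qed
  \<comment> \<open>For \<open>B = UNIV\<close> the law reads 1 = |A| / |A|. A null shell would make
    the right side 0, since \<open>0 / 0 = 0\<close> in \<open>ennreal\<close>.\<close>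
  have "emeasure lborel ?A \<noteq> 0"
    using law[of UNIV] P.emeasure_space_1 by auto
  then have N: "0 < g R - g 0" using shell[of R] assms(1) by (simp add: ennreal_eq_0_iff)
  \<comment> \<open>The distribution function of the distance; \<open>min a R\<close> freezes it at
    1 beyond \<open>R\<close>.\<close>
  define G where "G a = (if a < 0 then 0 else (g (min a R) - g 0) / (g R - g 0))" for a
  have "distributed P lborel (\<lambda>\<omega>. infdist (X \<omega>) S) (\<lambda>r. ennreal (?f r))"
  proof (rule distributedI_borel_atMost)
    have [measurable]: "g' \<in> borel_measurable borel"
      using cont by (rule borel_measurable_continuous_onI)
    show f_meas: "?f \<in> borel_measurable borel" by measurable
    show "(\<lambda>\<omega>. infdist (X \<omega>) S) \<in> borel_measurable P"
      using X by (rule borel_measurable_continuous_on[rotated]) (intro continuous_intros)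
    show "AE r in lborel. 0 \<le> ?f r" using g'_nonneg N by auto
    fix a :: real
    show "(\<integral>\<^sup>+r. ennreal (?f r * indicator {..a} r) \<partial>lborel) = ennreal (G a)"
    proof (cases "a < 0")
      case True
      then have "(\<integral>\<^sup>+r. ennreal (?f r * indicator {..a} r) \<partial>lborel) = (\<integral>\<^sup>+r. 0 \<partial>(lborel::real measure))"
        by (intro nn_integral_cong) (auto split: split_indicator)
      with True show ?thesis by (simp add: G_def)
    next
      case False
      \<comment> \<open>The integrands can differ only at \<open>r = R\<close>, where
        \<open>?f\<close> is 0 but the closed interval may still count.\<close>
      have "(\<integral>\<^sup>+r. ennreal (?f r * indicator {..a} r) \<partial>lborel)
          = (\<integral>\<^sup>+r. ennreal (g' r / (g R - g 0)) * indicator {0..min a R} r \<partial>lborel)"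
        using AE_lborel_singleton[of R]
        by (intro nn_integral_cong_AE) (auto elim!: eventually_mono split: split_indicator)
      also have "\<dots> = ennreal (g (min a R) / (g R - g 0) - g 0 / (g R - g 0))"
        using False assms(1) g'_nonneg N deriv
        by (intro nn_integral_FTC_Icc) (auto intro!: DERIV_cdivide)
      finally show ?thesis using False by (simp add: G_def diff_divide_distrib)
    qed
    show "emeasure P {\<omega> \<in> space P. infdist (X \<omega>) S \<le> a} = ennreal (G a)"
    proof (cases "a < 0")
      case True
      then have "\<not> infdist (X \<omega>) S \<le> a" for \<omega>
        using infdist_nonneg[of "X \<omega>" S] by simp
      with True show ?thesis by (simp add: G_def)
    next
      case False
      have "?A \<inter> parallel_set S a = parallel_set S (min a R) - S"
        by (auto simp: parallel_set_def)
      \<comment> \<open>The quotient of \<open>ennreal\<close> values becomes a real quotient only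
        for a nonnegative numerator.\<close>
      moreover have "g 0 \<le> g (min a R)"
        using \<open>mono_on {0..R} g\<close> False assms(1) by (auto elim!: mono_onD)
      ultimately show ?thesis
        using law[OF borel(1), of a] shell[of "min a R"] shell[of R] False assms(1) N
        by (simp add: G_def divide_ennreal parallel_set_def[of S a])
    qed
  qed
  moreover have "AE r in lborel. 0 \<le> ?f r" using g'_nonneg N by auto
  ultimately show ?thesis by (simp add: has_density_def)
qed

section \<open>Mixture decomposition\<close>

lemma beta_density_1_right:
  "0 < a \<Longrightarrow> beta_density a 1 x = (if 0 < x \<and> x < 1 then a * x powr (a - 1) else 0)"
  by (simp add: beta_density_def Beta_1_right)

lemma distance_density_mixture:
  assumes "0 < R"
  shows "distance_density R L0 M r
    = weight1 R L0 M * (if 0 \<le> r \<and> r < R then 1 / R else 0)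
    + weight2 R L0 M * (if 0 \<le> r \<and> r < R then 2 * r / R\<^sup>2 else 0)
    + weight3 R L0 M * (if 0 \<le> r \<and> r < R then 3 * r\<^sup>2 / R ^ 3 else 0)"
proof -
  \<comment> \<open>The common denominator of the weights; the normaliser of the density is
    \<open>R * d\<close>, and the spare \<open>R\<close> goes into the component densities.\<close>
  define d where "d = L0 + M * R + 4 * pi * R\<^sup>2 / 3"
  have "L0 * R + M * R\<^sup>2 + 4 / 3 * pi * R ^ 3 = R * d"
    by (simp add: d_def algebra_simps power2_eq_square power3_eq_cube)
  \<comment> \<open>For \<open>d = 0\<close> both sides vanish, as division by 0 yields 0.\<close>
  moreover have "(L0 + 2 * M * r + 4 * pi * r\<^sup>2) / (R * d)
      = L0 / d * (1 / R) + M * R / d * (2 * r / R\<^sup>2) + 4 * pi * R\<^sup>2 / 3 / d * (3 * r\<^sup>2 / R ^ 3)"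
    using assms by (cases "d = 0") (simp_all add: field_simps power2_eq_square power3_eq_cube)
  moreover have "weight1 R L0 M = L0 / d" "weight2 R L0 M = M * R / d"
    "weight3 R L0 M = 4 * pi * R\<^sup>2 / 3 / d"
    by (simp_all add: weight1_def weight2_def weight3_def d_def)
  ultimately show ?thesis
    by (cases "0 \<le> r \<and> r < R")
       (simp_all only: distance_density_def simp_thms if_True if_False mult_zero_right add_0_left)
qed

theorem proposition3:
  fixes R L0 M :: real and S :: "(real ^ 3) set"
    and P :: "'w measure" and X :: "'w \<Rightarrow> real ^ 3"
    and P1 :: "'w1 measure" and Z1 :: "'w1 \<Rightarrow> real"
    and P2 :: "'w2 measure" and Z2 :: "'w2 \<Rightarrow> real"
    and P3 :: "'w3 measure" and Z3 :: "'w3 \<Rightarrow> real"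
  assumes "R > 0" and "compact S" and "S \<noteq> {}"
    and "\<And>r. 0 \<le> r \<Longrightarrow> r < R \<Longrightarrow>
           volume_function r S = measure lborel S + L0 * r + M * r\<^sup>2 + 4 / 3 * pi * r ^ 3"
    and "prob_space P" and "uniformly_distributed P X (parallel_set S R - S)"
    and "prob_space P1" and "uniformly_distributed P1 Z1 {0<..<1}"
    and "prob_space P2" and "has_density P2 Z2 (beta_density 2 1)"
    and "prob_space P3" and "has_density P3 Z3 (beta_density 3 1)"
  shows "has_density P (\<lambda>\<omega>. infdist (X \<omega>) S) (distance_density R L0 M)
    \<and> (\<exists>f1 f2 f3.
          has_density P1 (\<lambda>\<omega>. R * Z1 \<omega>) f1 \<and>
          has_density P2 (\<lambda>\<omega>. R * Z2 \<omega>) f2 \<and>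
          has_density P3 (\<lambda>\<omega>. R * Z3 \<omega>) f3 \<and>
          (\<forall>r. 0 \<le> r \<and> r < R \<longrightarrow>
             distance_density R L0 M r
               = weight1 R L0 M * f1 r + weight2 R L0 M * f2 r + weight3 R L0 M * f3 r))
    \<and> (\<forall>f1 f2 f3.
          has_density P1 (\<lambda>\<omega>. R * Z1 \<omega>) f1 \<longrightarrow>
          has_density P2 (\<lambda>\<omega>. R * Z2 \<omega>) f2 \<longrightarrow>
          has_density P3 (\<lambda>\<omega>. R * Z3 \<omega>) f3 \<longrightarrow>
          (AE r in lborel. 0 \<le> r \<and> r < R \<longrightarrow>
             distance_density R L0 M r
               = weight1 R L0 M * f1 r + weight2 R L0 M * f2 r + weight3 R L0 M * f3 r))"
proof -
  \<comment> \<open>Versions of the component densities whose values at 0 make the mixture identity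
    hold at every point of \<open>[0, R)\<close>, not just almost everywhere.\<close>
  let ?g1 = "\<lambda>r. if 0 \<le> r \<and> r < R then 1 / R else 0"
  let ?g2 = "\<lambda>r. if 0 \<le> r \<and> r < R then 2 * r / R\<^sup>2 else 0"
  let ?g3 = "\<lambda>r. if 0 \<le> r \<and> r < R then 3 * r\<^sup>2 / R ^ 3 else 0"
  let ?V = "\<lambda>r. measure lborel S + L0 * r + M * r\<^sup>2 + 4 / 3 * pi * r ^ 3"
  have "has_density P (\<lambda>\<omega>. infdist (X \<omega>) S)
      (\<lambda>r. if 0 \<le> r \<and> r < R then (L0 + 2 * M * r + 4 * pi * r\<^sup>2) / (?V R - ?V 0) else 0)"
    using assms(1-6)
    by (intro has_density_infdist[where g = ?V])
       (auto intro!: derivative_eq_intros continuous_intros)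
  \<comment> \<open>In \<open>?V R - ?V 0\<close> the volume of \<open>S\<close> cancels, leaving
    the stated normaliser.\<close>
  moreover have "distance_density R L0 M
      = (\<lambda>r. if 0 \<le> r \<and> r < R then (L0 + 2 * M * r + 4 * pi * r\<^sup>2) / (?V R - ?V 0) else 0)"
    by (simp add: distance_density_def fun_eq_iff)
  ultimately have D: "has_density P (\<lambda>\<omega>. infdist (X \<omega>) S) (distance_density R L0 M)"
    by simp
  have g1: "has_density P1 (\<lambda>\<omega>. R * Z1 \<omega>) ?g1"
    using assms(1) uniformly_distributed_unit_interval[OF assms(8)]
    by (intro has_density_scaled[OF assms(7)]) (auto simp: indicator_def zero_less_divide_iff)
  have g2: "has_density P2 (\<lambda>\<omega>. R * Z2 \<omega>) ?g2"
    using assms(1,10)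
    by (intro has_density_scaled[OF assms(9), where h = "beta_density 2 1"])
       (auto simp: has_density_def beta_density_1_right power2_eq_square zero_less_divide_iff)
  have g3: "has_density P3 (\<lambda>\<omega>. R * Z3 \<omega>) ?g3"
    using assms(1,12)
    by (intro has_density_scaled[OF assms(11), where h = "beta_density 3 1"])
       (auto simp: has_density_def beta_density_1_right power2_eq_square power3_eq_cube
         powr_numeral zero_less_divide_iff)
  \<comment> \<open>Any other densities agree almost everywhere with \<open>?g1\<close>,
    \<open>?g2\<close> and \<open>?g3\<close>, so the pointwise identity survives off a null
    set.\<close>
  have "AE r in lborel. 0 \<le> r \<and> r < R \<longrightarrow> distance_density R L0 M r
      = weight1 R L0 M * f1 r + weight2 R L0 M * f2 r + weight3 R L0 M * f3 r"
    if "has_density P1 (\<lambda>\<omega>. R * Z1 \<omega>) f1" "has_density P2 (\<lambda>\<omega>. R * Z2 \<omega>) f2"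
      "has_density P3 (\<lambda>\<omega>. R * Z3 \<omega>) f3" for f1 f2 f3
    using has_density_unique[OF assms(7) that(1) g1] has_density_unique[OF assms(9) that(2) g2]
      has_density_unique[OF assms(11) that(3) g3]
    by eventually_elim (simp add: distance_density_mixture[OF assms(1)])
  then show ?thesis
    using D g1 g2 g3 distance_density_mixture[OF assms(1)] by blast
qed

end
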